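(* For each positive integer $n$ (and each $m\ge1$), the polynomial $$p_n(z;x_1,\dots,x_m)=\prod_{s_1,\dots,s_m=1}^n\bigl(\sqrt[n]{z}+\epsilon^{s_1}\sqrt[n]{x_1}+\dots+\epsilon^{s_m}\sqrt[n]{x_m}\bigr)$$ in the variables $z,x_1,\dots,x_m$ is irreducible over $\mathbb{C}$.
   Context: Here $\epsilon$ is a primitive $n$-th root of unity and $\sqrt[n]{\cdot}$ is a fixed choice of $n$-th root; the product does not depend on the choices and is a polynomial in $z,x_1,\dots,x_m$ with integer coefficients. *)

theory Defs
  imports
    Complex_Main
    "HOL-Library.Poly_Mapping"
    "HOL-Library.FuncSet"
    "HOL-Library.Cardinality"
    "HOL-Computational_Algebra.Computational_Algebra"
begin

text \<open>
  Multivariate polynomials with coefficients in \<open>'a\<close> and variables indexed by \<open>'v\<close> are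
  finitely supported functions from monomials to coefficients, a monomial being a finitely
  supported function from variables to exponents.  The ring structure is the convolution
  product provided by \<^theory>\<open>HOL-Library.Poly_Mapping\<close>.
\<close>

type_synonym ('v, 'a) mpoly = "('v \<Rightarrow>\<^sub>0 nat) \<Rightarrow>\<^sub>0 'a"

definition eval_monom :: "('v \<Rightarrow> 'a) \<Rightarrow> ('v \<Rightarrow>\<^sub>0 nat) \<Rightarrow> 'a::comm_semiring_1" where
  "eval_monom f \<alpha> = (\<Prod>v\<in>Poly_Mapping.keys \<alpha>. f v ^ Poly_Mapping.lookup \<alpha> v)"

definition eval_mpoly :: "('v \<Rightarrow> 'a) \<Rightarrow> ('v, 'a) mpoly \<Rightarrow> 'a::comm_semiring_1" where
  "eval_mpoly f p =
     (\<Sum>\<alpha>\<in>Poly_Mapping.keys p. Poly_Mapping.lookup p \<alpha> * eval_monom f \<alpha>)"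

definition primitive_root_of_unity :: "nat \<Rightarrow> complex \<Rightarrow> bool" where
  "primitive_root_of_unity n \<epsilon> \<longleftrightarrow> n > 0 \<and> \<epsilon> ^ n = 1 \<and> (\<forall>k. 0 < k \<and> k < n \<longrightarrow> \<epsilon> ^ k \<noteq> 1)"

text \<open>
  \<open>root_product n \<epsilon> w y\<close> is the product of all \<open>w + \<epsilon> ^ s\<^sub>1 * y\<^sub>1 + \<dots> + \<epsilon> ^ s\<^sub>m * y\<^sub>m\<close> with
  \<open>s\<^sub>1, \<dots>, s\<^sub>m\<close> ranging independently over \<open>{1..n}\<close>; the index type \<open>'m\<close> plays the role of
  \<open>{1, \<dots>, m}\<close>, so that \<open>m = CARD('m) \<ge> 1\<close>.
\<close>

definition root_product :: "nat \<Rightarrow> complex \<Rightarrow> complex \<Rightarrow> ('m::finite \<Rightarrow> complex) \<Rightarrow> complex" where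
  "root_product n \<epsilon> w y =
     (\<Prod>s\<in>(\<Pi>\<^sub>E i\<in>(UNIV::'m set). {1..n}). w + (\<Sum>i\<in>UNIV. \<epsilon> ^ s i * y i))"

text \<open>
  The polynomial \<open>p\<^sub>n(z; x\<^sub>1, \<dots>, x\<^sub>m)\<close>, in the variables \<open>None\<close> (for \<open>z\<close>) and \<open>Some i\<close>
  (for \<open>x\<^sub>i\<close>).  The function \<open>r\<close> is the chosen \<open>n\<close>-th root.  Existence and uniqueness are
  the lemma \<open>ex1_root_poly\<close> below; independence of \<open>r\<close> and \<open>\<epsilon>\<close> is \<open>root_poly_indep\<close>.
\<close>

definition root_poly ::
  "nat \<Rightarrow> complex \<Rightarrow> (complex \<Rightarrow> complex) \<Rightarrow> ('m::finite option, complex) mpoly" where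
  "root_poly n \<epsilon> r = (THE p. \<forall>z x.
     eval_mpoly (case_option z x) p = root_product n \<epsilon> (r z) (\<lambda>i. r (x i)))"


subsection \<open>Evaluation\<close>

lemma eval_monom_superset:
  assumes "finite A" "Poly_Mapping.keys \<alpha> \<subseteq> A"
  shows "eval_monom f \<alpha> = (\<Prod>v\<in>A. f v ^ Poly_Mapping.lookup \<alpha> v)"
  unfolding eval_monom_def
  by (rule prod.mono_neutral_left) (use assms in \<open>auto simp: in_keys_iff\<close>)

lemma eval_monom_finite:
  fixes f :: "'v::finite \<Rightarrow> 'a::comm_semiring_1"
  shows "eval_monom f \<alpha> = (\<Prod>v\<in>UNIV. f v ^ Poly_Mapping.lookup \<alpha> v)"
  by (rule eval_monom_superset) auto

lemma eval_monom_add: "eval_monom f (\<alpha> + \<beta>) = eval_monom f \<alpha> * eval_monom f \<beta>"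
proof -
  let ?A = "Poly_Mapping.keys \<alpha> \<union> Poly_Mapping.keys \<beta>"
  have "Poly_Mapping.keys (\<alpha> + \<beta>) \<subseteq> ?A"
    by (rule keys_add)
  then show ?thesis
    by (simp add: eval_monom_superset[of ?A] lookup_add power_add prod.distrib)
qed

lemma eval_mpoly_superset:
  assumes "finite A" "Poly_Mapping.keys p \<subseteq> A"
  shows "eval_mpoly f p = (\<Sum>\<alpha>\<in>A. Poly_Mapping.lookup p \<alpha> * eval_monom f \<alpha>)"
  unfolding eval_mpoly_def
  by (rule sum.mono_neutral_left) (use assms in \<open>auto simp: in_keys_iff\<close>)

lemma eval_mpoly_zero [simp]: "eval_mpoly f 0 = 0"
  by (simp add: eval_mpoly_def)

lemma eval_mpoly_single [simp]:
  "eval_mpoly f (Poly_Mapping.single \<alpha> c) = c * eval_monom f \<alpha>"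
  by (subst eval_mpoly_superset[of "{\<alpha>}"]) auto

lemma eval_mpoly_one [simp]: "eval_mpoly f 1 = 1"
  by (simp add: single_one[symmetric] eval_monom_def del: single_one)

lemma eval_mpoly_add: "eval_mpoly f (p + q) = eval_mpoly f p + eval_mpoly f q"
proof -
  let ?A = "Poly_Mapping.keys p \<union> Poly_Mapping.keys q"
  have "Poly_Mapping.keys (p + q) \<subseteq> ?A"
    by (rule keys_add)
  then show ?thesis
    by (simp add: eval_mpoly_superset[of ?A] lookup_add algebra_simps sum.distrib)
qed

lemma eval_mpoly_sum: "eval_mpoly f (sum g A) = (\<Sum>a\<in>A. eval_mpoly f (g a))"
  by (induction A rule: infinite_finite_induct) (auto simp: eval_mpoly_add)

lemma mpoly_expand:
  "p = (\<Sum>\<alpha>\<in>Poly_Mapping.keys p. Poly_Mapping.single \<alpha> (Poly_Mapping.lookup p \<alpha>))"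
  by (rule poly_mapping_eqI)
    (auto simp: lookup_sum lookup_single when_def in_keys_iff sum.delta)

lemma eval_mpoly_mult: "eval_mpoly f (p * q) = eval_mpoly f p * eval_mpoly f q"
proof -
  have "eval_mpoly f (p * q) =
    eval_mpoly f ((\<Sum>\<alpha>\<in>Poly_Mapping.keys p. Poly_Mapping.single \<alpha> (Poly_Mapping.lookup p \<alpha>)) *
      (\<Sum>\<beta>\<in>Poly_Mapping.keys q. Poly_Mapping.single \<beta> (Poly_Mapping.lookup q \<beta>)))"
    using mpoly_expand[of p] mpoly_expand[of q] by simp
  also have "\<dots> = eval_mpoly f p * eval_mpoly f q"
    by (simp add: sum_product mult_single eval_mpoly_sum eval_monom_add)
      (simp add: eval_mpoly_def sum_product algebra_simps)
  finally show ?thesis .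
qed

lemma eval_mpoly_prod: "eval_mpoly f (prod g A) = (\<Prod>a\<in>A. eval_mpoly f (g a))"
  by (induction A rule: infinite_finite_induct) (auto simp: eval_mpoly_mult)

lemma eval_mpoly_diff:
  fixes p q :: "('v, 'a::comm_ring_1) mpoly"
  shows "eval_mpoly f (p - q) = eval_mpoly f p - eval_mpoly f q"
  using eval_mpoly_add[of f "p - q" q] by simp


subsection \<open>A polynomial over the complex numbers is determined by its values\<close>

lemma base_digits_inj:
  fixes a b :: "nat \<Rightarrow> nat"
  assumes "\<And>i. i < k \<Longrightarrow> a i < N" "\<And>i. i < k \<Longrightarrow> b i < N"
    and "(\<Sum>i<k. a i * N ^ i) = (\<Sum>i<k. b i * N ^ i)" "i < k"
  shows "a i = b i"
  using assms
proof (induction k arbitrary: a b i)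
  case 0
  then show ?case by simp
next
  case (Suc k)
  have shift: "(\<Sum>i<Suc k. c i * N ^ i) = c 0 + N * (\<Sum>i<k. c (Suc i) * N ^ i)" for c :: "nat \<Rightarrow> nat"
    by (simp add: sum.lessThan_Suc_shift sum_distrib_left algebra_simps del: sum.lessThan_Suc)
  have eq: "a 0 + N * (\<Sum>i<k. a (Suc i) * N ^ i) = b 0 + N * (\<Sum>i<k. b (Suc i) * N ^ i)"
    using Suc.prems(3) unfolding shift .
  have a0: "a 0 < N" and b0: "b 0 < N"
    using Suc.prems(1,2) by auto
  have "(a 0 + N * (\<Sum>i<k. a (Suc i) * N ^ i)) mod N = (b 0 + N * (\<Sum>i<k. b (Suc i) * N ^ i)) mod N"
    using eq by simp
  then have 0: "a 0 = b 0"
    using a0 b0 by simp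
  then have "(\<Sum>i<k. a (Suc i) * N ^ i) = (\<Sum>i<k. b (Suc i) * N ^ i)"
    using eq a0 by simp
  then have "a (Suc j) = b (Suc j)" if "j < k" for j
    using Suc.IH[of "\<lambda>i. a (Suc i)" "\<lambda>i. b (Suc i)" j] Suc.prems(1,2) that by auto
  with 0 show ?case
    using Suc.prems(4) by (cases i) auto
qed

lemma eval_mpoly_eq_0_imp:
  fixes p :: "('v::finite, complex) mpoly"
  assumes zero: "\<And>f. eval_mpoly f p = 0"
  shows "p = 0"
proof (rule ccontr)
  assume "p \<noteq> 0"
  then obtain \<alpha>0 where \<alpha>0: "\<alpha>0 \<in> Poly_Mapping.keys p"
    by (metis in_keys_iff lookup_zero poly_mapping_eqI)
  obtain h :: "'v \<Rightarrow> nat" where h: "bij_betw h UNIV {..<CARD('v)}"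
    using ex_bij_betw_finite_nat[of "UNIV :: 'v set"] by (auto simp: atLeast0LessThan)
  define g where "g = inv_into UNIV h"
  have g: "bij_betw g {..<CARD('v)} UNIV"
    unfolding g_def by (rule bij_betw_inv_into[OF h])
  have hg: "h (g i) = i" if "i < CARD('v)" for i
    unfolding g_def using h that by (auto simp: bij_betw_def intro: f_inv_into_f)
  define E where "E = (\<lambda>(\<alpha>, v). Poly_Mapping.lookup \<alpha> v) ` (Poly_Mapping.keys p \<times> (UNIV :: 'v set))"
  define N where "N = Suc (Max E)"
  have finE: "finite E"
    unfolding E_def by simp
  have bound: "Poly_Mapping.lookup \<alpha> v < N" if "\<alpha> \<in> Poly_Mapping.keys p" for \<alpha> v
    unfolding N_def using that by (auto simp: less_Suc_eq_le E_def intro!: Max_ge finE[unfolded E_def])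
  define e where "e \<alpha> = (\<Sum>i<CARD('v). Poly_Mapping.lookup \<alpha> (g i) * N ^ i)" for \<alpha> :: "'v \<Rightarrow>\<^sub>0 nat"
  have inj: "inj_on e (Poly_Mapping.keys p)"
  proof (rule inj_onI)
    fix \<alpha> \<beta> assume ab: "\<alpha> \<in> Poly_Mapping.keys p" "\<beta> \<in> Poly_Mapping.keys p" "e \<alpha> = e \<beta>"
    show "\<alpha> = \<beta>"
    proof (rule poly_mapping_eqI)
      fix v
      obtain i where "i < CARD('v)" "v = g i"
        using g by (metis UNIV_I bij_betw_def imageE lessThan_iff)
      then show "Poly_Mapping.lookup \<alpha> v = Poly_Mapping.lookup \<beta> v"
        using base_digits_inj[of "CARD('v)" "\<lambda>i. Poly_Mapping.lookup \<alpha> (g i)" N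
            "\<lambda>i. Poly_Mapping.lookup \<beta> (g i)" i] ab bound
        unfolding e_def by auto
    qed
  qed
  define q where "q = (\<Sum>\<alpha>\<in>Poly_Mapping.keys p. monom (Poly_Mapping.lookup p \<alpha>) (e \<alpha>))"
  have "poly q t = 0" for t
  proof -
    have mon: "eval_monom (\<lambda>v. t ^ (N ^ h v)) \<alpha> = t ^ e \<alpha>" for \<alpha>
    proof -
      have "eval_monom (\<lambda>v. t ^ (N ^ h v)) \<alpha> = (\<Prod>v\<in>UNIV. (t ^ (N ^ h v)) ^ Poly_Mapping.lookup \<alpha> v)"
        by (rule eval_monom_finite)
      also have "\<dots> = (\<Prod>i<CARD('v). (t ^ (N ^ h (g i))) ^ Poly_Mapping.lookup \<alpha> (g i))"
        by (rule prod.reindex_bij_betw[OF g, symmetric])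
      also have "\<dots> = (\<Prod>i<CARD('v). t ^ (Poly_Mapping.lookup \<alpha> (g i) * N ^ i))"
        by (rule prod.cong) (auto simp: hg power_mult[symmetric] mult.commute)
      also have "\<dots> = t ^ e \<alpha>"
        by (simp add: e_def power_sum)
      finally show ?thesis .
    qed
    have "poly q t = eval_mpoly (\<lambda>v. t ^ (N ^ h v)) p"
      by (simp add: q_def poly_sum poly_monom eval_mpoly_def mon)
    then show ?thesis
      using zero by simp
  qed
  then have "q = 0"
    using poly_all_0_iff_0 by blast
  moreover have "coeff q (e \<alpha>0) = Poly_Mapping.lookup p \<alpha>0"
  proof -
    have "coeff q (e \<alpha>0) = (\<Sum>\<alpha>\<in>Poly_Mapping.keys p. if \<alpha> = \<alpha>0 then Poly_Mapping.lookup p \<alpha> else 0)"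
      unfolding q_def coeff_sum
      by (rule sum.cong) (use inj \<alpha>0 in \<open>auto simp: inj_on_def\<close>)
    then show ?thesis
      using \<alpha>0 by simp
  qed
  ultimately show False
    using \<alpha>0 by (simp add: in_keys_iff)
qed

lemma mpoly_eqI:
  fixes p q :: "('v::finite, complex) mpoly"
  assumes "\<And>f. eval_mpoly f p = eval_mpoly f q"
  shows "p = q"
  using eval_mpoly_eq_0_imp[of "p - q"] assms by (simp add: eval_mpoly_diff)


subsection \<open>The polynomial is well defined\<close>

lemma root_of_unity_power_mod:
  assumes "primitive_root_of_unity n \<epsilon>"
  shows "\<epsilon> ^ (k mod n) = \<epsilon> ^ k"
proof -
  have "\<epsilon> ^ k = \<epsilon> ^ (n * (k div n) + k mod n)"
    by simp
  also have "\<dots> = \<epsilon> ^ (k mod n)"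
    using assms by (simp only: power_add power_mult) (simp add: primitive_root_of_unity_def)
  finally show ?thesis ..
qed

lemma root_of_unity_power_eq_1_iff:
  assumes "primitive_root_of_unity n \<epsilon>"
  shows "\<epsilon> ^ k = 1 \<longleftrightarrow> n dvd k"
proof
  assume "\<epsilon> ^ k = 1"
  then have "\<epsilon> ^ (k mod n) = 1"
    using root_of_unity_power_mod[OF assms] by simp
  moreover have "k mod n < n"
    using assms by (simp add: primitive_root_of_unity_def)
  ultimately have "k mod n = 0"
    using assms unfolding primitive_root_of_unity_def by (metis gr0I)
  then show "n dvd k"
    by auto
next
  assume "n dvd k"
  then show "\<epsilon> ^ k = 1"
    using assms by (auto simp: primitive_root_of_unity_def power_mult)
qed

lemma bij_betw_roots_of_unity:
  assumes "primitive_root_of_unity n \<epsilon>"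
  shows "bij_betw (\<lambda>k. \<epsilon> ^ k) {1..n} {u. u ^ n = 1}"
proof -
  have n: "n > 0" and \<epsilon>n: "\<epsilon> ^ n = 1"
    using assms by (auto simp: primitive_root_of_unity_def)
  then have \<epsilon>0: "\<epsilon> \<noteq> 0"
    by (auto simp: power_0_left)
  have less: "j = k" if "j \<le> k" "j \<in> {1..n}" "k \<in> {1..n}" "\<epsilon> ^ j = \<epsilon> ^ k" for j k
  proof -
    have "\<epsilon> ^ (k - j) = 1"
      using that \<epsilon>0 by (simp add: power_diff)
    then have "n dvd k - j"
      using root_of_unity_power_eq_1_iff[OF assms] by simp
    moreover have "k - j < n"
      using that by auto
    ultimately show ?thesis
      using that(1) by (auto dest: dvd_imp_le)
  qed
  then have inj: "inj_on (\<lambda>k. \<epsilon> ^ k) {1..n}"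
    by (intro inj_onI) (metis nle_le)
  have sub: "(\<lambda>k. \<epsilon> ^ k) ` {1..n} \<subseteq> {u. u ^ n = 1}"
    using \<epsilon>n by (auto simp: power_mult[symmetric] mult.commute[of _ n]) (simp add: power_mult)
  have "card ((\<lambda>k. \<epsilon> ^ k) ` {1..n}) = card {u::complex. u ^ n = 1}"
    using card_image[OF inj] card_roots_unity_eq[OF n] by simp
  then have "(\<lambda>k. \<epsilon> ^ k) ` {1..n} = {u. u ^ n = 1}"
    using sub n by (intro card_subset_eq finite_roots_unity) auto
  with inj show ?thesis
    by (simp add: bij_betw_def)
qed

lemma root_product_altdef:
  fixes y :: "'m::finite \<Rightarrow> complex"
  assumes "primitive_root_of_unity n \<epsilon>"
  shows "root_product n \<epsilon> w y =
    (\<Prod>u\<in>(UNIV \<rightarrow> {u. u ^ n = 1}). w + (\<Sum>i\<in>UNIV. u i * y i))"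
proof -
  let ?e = "\<lambda>k. \<epsilon> ^ k" and ?U = "{u::complex. u ^ n = 1}"
  have bij: "bij_betw ?e {1..n} ?U"
    by (rule bij_betw_roots_of_unity[OF assms])
  have "bij_betw (\<lambda>s i. ?e (s i)) (\<Pi>\<^sub>E i\<in>(UNIV::'m set). {1..n}) (UNIV \<rightarrow> ?U)"
  proof (rule bij_betwI[where g = "\<lambda>u i. inv_into {1..n} ?e (u i)"])
    show "(\<lambda>s i. ?e (s i)) \<in> (\<Pi>\<^sub>E i\<in>(UNIV::'m set). {1..n}) \<rightarrow> (UNIV \<rightarrow> ?U)"
      using bij_betwE[OF bij] by (simp add: Pi_iff PiE_UNIV_domain)
    show "(\<lambda>u i. inv_into {1..n} ?e (u i)) \<in> (UNIV \<rightarrow> ?U) \<rightarrow> (\<Pi>\<^sub>E i\<in>(UNIV::'m set). {1..n})"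
      using bij_betwE[OF bij_betw_inv_into[OF bij]] by (simp add: Pi_iff PiE_UNIV_domain)
  next
    fix s assume "s \<in> (\<Pi>\<^sub>E i\<in>(UNIV::'m set). {1..n})"
    then show "(\<lambda>i. inv_into {1..n} ?e (?e (s i))) = s"
      by (intro ext bij_betw_inv_into_left[OF bij]) (auto simp: PiE_UNIV_domain)
  next
    fix u :: "'m \<Rightarrow> complex" assume "u \<in> UNIV \<rightarrow> ?U"
    then show "(\<lambda>i. ?e (inv_into {1..n} ?e (u i))) = u"
      by (intro ext bij_betw_inv_into_right[OF bij]) auto
  qed
  from prod.reindex_bij_betw[OF this, of "\<lambda>u. w + (\<Sum>i\<in>UNIV. u i * y i)"]
  show ?thesis
    by (simp add: root_product_def)
qed

lemma root_product_rotate: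
  fixes y :: "'m::finite \<Rightarrow> complex"
  assumes \<epsilon>: "primitive_root_of_unity n \<epsilon>" and a: "a ^ n = 1" and b: "\<And>i. b i ^ n = 1"
  shows "root_product n \<epsilon> (a * w) (\<lambda>i. b i * y i) = root_product n \<epsilon> w y"
proof -
  let ?U = "{u::complex. u ^ n = 1}"
  let ?A = "UNIV \<rightarrow> ?U :: ('m \<Rightarrow> complex) set"
  have n: "n > 0"
    using \<epsilon> by (simp add: primitive_root_of_unity_def)
  have "c \<noteq> 0" if "c ^ n = 1" for c :: complex
    using that n by (auto simp: power_0_left)
  then have nz: "a \<noteq> 0" "\<And>i. b i \<noteq> 0"
    using a b by blast+
  have bij: "bij_betw (\<lambda>u i. u i * b i / a) ?A ?A"
    by (rule bij_betwI[where g = "\<lambda>u i. u i * a / b i"])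
      (use a b nz in \<open>auto simp: Pi_iff power_mult_distrib power_divide\<close>)
  have "n dvd n ^ CARD('m)"
    by (simp add: dvd_power)
  moreover have "card ?A = n ^ CARD('m)"
    using card_PiE[of "UNIV :: 'm set" "\<lambda>_. ?U"] card_roots_unity_eq[OF n]
    by (simp add: PiE_UNIV_domain)
  ultimately have pow: "a ^ card ?A = 1"
    using a by (metis dvdE power_mult power_one)
  have "root_product n \<epsilon> (a * w) (\<lambda>i. b i * y i)
    = (\<Prod>u\<in>?A. a * w + (\<Sum>i\<in>UNIV. u i * (b i * y i)))"
    by (rule root_product_altdef[OF \<epsilon>])
  also have "\<dots> = (\<Prod>u\<in>?A. a * (w + (\<Sum>i\<in>UNIV. (u i * b i / a) * y i)))"
    using nz by (intro prod.cong) (auto simp: sum_distrib_left distrib_left mult.assoc)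
  also have "\<dots> = (\<Prod>u\<in>?A. w + (\<Sum>i\<in>UNIV. (u i * b i / a) * y i))"
    by (simp add: prod.distrib pow)
  also have "\<dots> = (\<Prod>u\<in>?A. w + (\<Sum>i\<in>UNIV. u i * y i))"
    by (rule prod.reindex_bij_betw[OF bij])
  also have "\<dots> = root_product n \<epsilon> w y"
    by (rule root_product_altdef[OF \<epsilon>, symmetric])
  finally show ?thesis .
qed

lemma root_product_cong_power:
  fixes y :: "'m::finite \<Rightarrow> complex"
  assumes \<epsilon>: "primitive_root_of_unity n \<epsilon>" "w' ^ n = w ^ n" "\<And>i. y' i ^ n = y i ^ n"
  shows "root_product n \<epsilon> w' y' = root_product n \<epsilon> w y"
proof -
  have n: "n > 0"
    using \<epsilon> by (simp add: primitive_root_of_unity_def)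
  have ex: "\<exists>c. c ^ n = 1 \<and> t' = c * t" if "t' ^ n = t ^ n" for t t' :: complex
  proof (cases "t = 0")
    case True
    then show ?thesis
      using that n by (intro exI[of _ 1]) (simp add: power_0_left)
  next
    case False
    then show ?thesis
      using that by (intro exI[of _ "t' / t"]) (simp add: power_divide)
  qed
  obtain a where "a ^ n = 1" "w' = a * w"
    using ex assms(2) by blast
  moreover have "\<forall>i. \<exists>c. c ^ n = 1 \<and> y' i = c * y i"
    using ex assms(3) by blast
  then obtain b where b: "\<And>i. b i ^ n = 1" "\<And>i. y' i = b i * y i"
    by metis
  moreover have "y' = (\<lambda>i. b i * y i)"
    using b(2) by (rule ext)
  ultimately show ?thesis
    using root_product_rotate[OF \<epsilon>(1), of a b w y] by simp
qed

lemma ex_root_poly: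
  assumes \<epsilon>: "primitive_root_of_unity n \<epsilon>"
  shows "\<exists>p :: ('m::finite option, complex) mpoly. \<forall>w y.
    eval_mpoly (case_option (w ^ n) (\<lambda>i. y i ^ n)) p = root_product n \<epsilon> w y"
proof -
  have n: "n > 0"
    using \<epsilon> by (simp add: primitive_root_of_unity_def)
  define X :: "'m option \<Rightarrow> ('m option, complex) mpoly"
    where "X v = Poly_Mapping.single (Poly_Mapping.single v 1) 1" for v
  define C :: "complex \<Rightarrow> ('m option, complex) mpoly" where "C c = Poly_Mapping.single 0 c" for c
  have evX: "eval_mpoly f (X v) = f v" for f v
    by (simp add: X_def eval_monom_def)
  have evC: "eval_mpoly f (C c) = c" for f c
    by (simp add: C_def eval_monom_def)
  define P where "P = (\<Prod>s\<in>(\<Pi>\<^sub>E i\<in>(UNIV::'m set). {1..n}).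
    X None + (\<Sum>i\<in>UNIV. C (\<epsilon> ^ s i) * X (Some i)))"
  have evP: "eval_mpoly f P = root_product n \<epsilon> (f None) (\<lambda>i. f (Some i))" for f
    unfolding P_def root_product_def
    by (simp add: eval_mpoly_prod eval_mpoly_add eval_mpoly_sum eval_mpoly_mult evX evC)
  have dvd: "n dvd Poly_Mapping.lookup \<alpha> v" if \<alpha>: "\<alpha> \<in> Poly_Mapping.keys P" for \<alpha> v
  proof -
    define b where "b = (\<lambda>u. if u = v then \<epsilon> else 1)"
    have bn: "b u ^ n = 1" for u
      using \<epsilon> by (simp add: b_def primitive_root_of_unity_def)
    define P' where "P' = (\<Sum>\<alpha>\<in>Poly_Mapping.keys P.
      Poly_Mapping.single \<alpha> (Poly_Mapping.lookup P \<alpha> * eval_monom b \<alpha>))"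
    have "eval_mpoly f P' = eval_mpoly f P" for f
    proof -
      have mon: "eval_monom b \<alpha> * eval_monom f \<alpha> = eval_monom (\<lambda>u. b u * f u) \<alpha>" for \<alpha>
        by (simp add: eval_monom_def power_mult_distrib prod.distrib)
      have "eval_mpoly f P' = eval_mpoly (\<lambda>u. b u * f u) P"
        by (simp add: P'_def eval_mpoly_sum mult.assoc mon) (simp add: eval_mpoly_def)
      also have "\<dots> = eval_mpoly f P"
        unfolding evP by (rule root_product_rotate[OF \<epsilon> bn bn])
      finally show ?thesis .
    qed
    then have "P' = P"
      by (rule mpoly_eqI)
    moreover have "Poly_Mapping.lookup P' \<alpha> = Poly_Mapping.lookup P \<alpha> * eval_monom b \<alpha>"
      using \<alpha> by (simp add: P'_def lookup_sum lookup_single when_def)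
    ultimately have "eval_monom b \<alpha> = 1"
      using \<alpha> by (simp add: in_keys_iff)
    moreover have "eval_monom b \<alpha> = (\<Prod>u\<in>UNIV. if u = v then \<epsilon> ^ Poly_Mapping.lookup \<alpha> v else 1)"
      unfolding eval_monom_finite by (rule prod.cong) (auto simp: b_def)
    ultimately show ?thesis
      using root_of_unity_power_eq_1_iff[OF \<epsilon>] by simp
  qed
  define d :: "('m option \<Rightarrow>\<^sub>0 nat) \<Rightarrow> 'm option \<Rightarrow>\<^sub>0 nat"
    where "d = Poly_Mapping.map (\<lambda>k. k div n)"
  have d: "Poly_Mapping.lookup (d \<alpha>) v = Poly_Mapping.lookup \<alpha> v div n" for \<alpha> v
    by (simp add: d_def map.rep_eq when_def)
  define Q where "Q = (\<Sum>\<alpha>\<in>Poly_Mapping.keys P. Poly_Mapping.single (d \<alpha>) (Poly_Mapping.lookup P \<alpha>))"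
  have evQ: "eval_mpoly (\<lambda>v. f v ^ n) Q = eval_mpoly f P" for f
  proof -
    have "eval_monom (\<lambda>v. f v ^ n) (d \<alpha>) = eval_monom f \<alpha>" if "\<alpha> \<in> Poly_Mapping.keys P" for \<alpha>
      unfolding eval_monom_finite using dvd[OF that]
      by (intro prod.cong) (auto simp: d power_mult[symmetric])
    then show ?thesis
      by (simp add: Q_def eval_mpoly_sum) (simp add: eval_mpoly_def)
  qed
  have "eval_mpoly (case_option (w ^ n) (\<lambda>i. y i ^ n)) Q = root_product n \<epsilon> w y" for w y
  proof -
    have "case_option (w ^ n) (\<lambda>i. y i ^ n) = (\<lambda>v. case_option w y v ^ n)"
      by (auto split: option.split)
    then show ?thesis
      by (simp add: evQ evP)
  qed
  then show ?thesis
    by blast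
qed

lemma ex1_root_poly:
  assumes \<epsilon>: "primitive_root_of_unity n \<epsilon>" and r: "\<And>t. r t ^ n = t"
  shows "\<exists>!p :: ('m::finite option, complex) mpoly. \<forall>z x.
    eval_mpoly (case_option z x) p = root_product n \<epsilon> (r z) (\<lambda>i. r (x i))"
proof (rule ex_ex1I)
  obtain p :: "('m option, complex) mpoly"
    where p: "\<And>w y. eval_mpoly (case_option (w ^ n) (\<lambda>i. y i ^ n)) p = root_product n \<epsilon> w y"
    using ex_root_poly[OF \<epsilon>] by blast
  have "eval_mpoly (case_option z x) p = root_product n \<epsilon> (r z) (\<lambda>i. r (x i))" for z x
    using p[of "r z" "\<lambda>i. r (x i)"] by (simp add: r)
  then show "\<exists>p :: ('m option, complex) mpoly. \<forall>z x.
    eval_mpoly (case_option z x) p = root_product n \<epsilon> (r z) (\<lambda>i. r (x i))"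
    by blast
next
  fix p q :: "('m option, complex) mpoly"
  assume pq: "\<forall>z x. eval_mpoly (case_option z x) p = root_product n \<epsilon> (r z) (\<lambda>i. r (x i))"
    "\<forall>z x. eval_mpoly (case_option z x) q = root_product n \<epsilon> (r z) (\<lambda>i. r (x i))"
  show "p = q"
  proof (rule mpoly_eqI)
    fix f :: "'m option \<Rightarrow> complex"
    have "f = case_option (f None) (\<lambda>i. f (Some i))"
      by (auto split: option.split)
    then show "eval_mpoly f p = eval_mpoly f q"
      using pq by metis
  qed
qed

lemma eval_root_poly:
  fixes x :: "'m::finite \<Rightarrow> complex"
  assumes \<epsilon>: "primitive_root_of_unity n \<epsilon>" and r: "\<And>t. r t ^ n = t"
    and w: "w ^ n = z" and y: "\<And>i. y i ^ n = x i"
  shows "eval_mpoly (case_option z x) (root_poly n \<epsilon> r) = root_product n \<epsilon> w y"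
proof -
  have "eval_mpoly (case_option z x) (root_poly n \<epsilon> r) = root_product n \<epsilon> (r z) (\<lambda>i. r (x i))"
    using theI'[OF ex1_root_poly[where r = r, OF \<epsilon> r]] unfolding root_poly_def by blast
  also have "\<dots> = root_product n \<epsilon> w y"
    by (rule root_product_cong_power[OF \<epsilon>]) (simp_all add: r w y)
  finally show ?thesis .
qed

lemma root_poly_indep:
  assumes "primitive_root_of_unity n \<epsilon>" "\<And>t. r t ^ n = t"
    and "primitive_root_of_unity n \<epsilon>'" "\<And>t. r' t ^ n = t"
  shows "(root_poly n \<epsilon> r :: ('m::finite option, complex) mpoly) = root_poly n \<epsilon>' r'"
proof (rule mpoly_eqI)
  fix f :: "'m option \<Rightarrow> complex"
  have f: "f = case_option (f None) (\<lambda>i. f (Some i))"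
    by (auto split: option.split)
  have "eval_mpoly f (root_poly n \<epsilon> r) = root_product n \<epsilon> (r (f None)) (\<lambda>i. r (f (Some i)))"
    by (subst f, rule eval_root_poly) (use assms in auto)
  also have "\<dots> = root_product n \<epsilon>' (r (f None)) (\<lambda>i. r (f (Some i)))"
    by (simp add: root_product_altdef[OF assms(1)] root_product_altdef[OF assms(3)])
  also have "\<dots> = eval_mpoly f (root_poly n \<epsilon>' r')"
    by (subst (3) f, rule eval_root_poly[symmetric]) (use assms in auto)
  finally show "eval_mpoly f (root_poly n \<epsilon> r) = eval_mpoly f (root_poly n \<epsilon>' r')" .
qed

end

theory Submission
  imports Defs
begin

text \<open>
  After substituting \<open>z = w ^ n\<close> and \<open>x i = y i ^ n\<close>, the polynomial becomes the product of the
  linear forms \<open>w + (\<Sum>i. u i * y i)\<close>, where the \<open>u i\<close> are \<open>n\<close>-th roots of unity.  If it factors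
  as \<open>A * B\<close>, one factor, say \<open>A\<close>, vanishes on the hyperplane of the form with all \<open>u i = 1\<close>;
  as \<open>A\<close> only depends on \<open>n\<close>-th powers, it vanishes on all the hyperplanes.  On a generic line the
  hyperplanes have as many distinct points as there are forms, so \<open>A\<close> has the full degree there
  and \<open>B\<close> is constant on the line.  The lines through one suitable point suffice to make \<open>B\<close> constant.
\<close>

section \<open>Functions that are polynomial along every line\<close>

text \<open>Only restrictions to lines matter in the proof, so that degrees and zeros are always
  those of univariate polynomials. The coefficient polynomial may vary with the line.\<close>

definition polynomial_on_lines :: "(('i \<Rightarrow> 'a) \<Rightarrow> 'a::comm_ring_1) \<Rightarrow> bool" where
  "polynomial_on_lines F \<longleftrightarrow> (\<forall>a b. \<exists>P. \<forall>t. F (\<lambda>i. a i + t * b i) = poly P t)"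

lemma polynomial_on_linesE:
  assumes "polynomial_on_lines F"
  obtains P where "\<And>t. F (\<lambda>i. a i + t * b i) = poly P t"
  using assms unfolding polynomial_on_lines_def by blast

lemma polynomial_on_lines_const: "polynomial_on_lines (\<lambda>x. c)"
  unfolding polynomial_on_lines_def by (intro allI exI[of _ "[:c:]"]) simp

lemma polynomial_on_lines_coord: "polynomial_on_lines (\<lambda>x. x i)"
  unfolding polynomial_on_lines_def
proof (intro allI)
  fix a b :: "'a \<Rightarrow> 'b"
  show "\<exists>P. \<forall>t. a i + t * b i = poly P t"
    by (rule exI[of _ "[:a i, b i:]"]) simp
qed

lemma polynomial_on_lines_add:
  assumes "polynomial_on_lines F" "polynomial_on_lines G"
  shows "polynomial_on_lines (\<lambda>x. F x + G x)"
  using assms unfolding polynomial_on_lines_def by (metis poly_add)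

lemma polynomial_on_lines_mult:
  assumes "polynomial_on_lines F" "polynomial_on_lines G"
  shows "polynomial_on_lines (\<lambda>x. F x * G x)"
  using assms unfolding polynomial_on_lines_def by (metis poly_mult)

lemma polynomial_on_lines_minus:
  assumes "polynomial_on_lines F"
  shows "polynomial_on_lines (\<lambda>x. - F x)"
  using assms unfolding polynomial_on_lines_def by (metis poly_minus)

lemma polynomial_on_lines_diff:
  assumes "polynomial_on_lines F" "polynomial_on_lines G"
  shows "polynomial_on_lines (\<lambda>x. F x - G x)"
  using assms unfolding polynomial_on_lines_def by (metis poly_diff)

lemma polynomial_on_lines_power:
  assumes "polynomial_on_lines F"
  shows "polynomial_on_lines (\<lambda>x. F x ^ k)"
  using assms unfolding polynomial_on_lines_def by (metis poly_power)

lemma polynomial_on_lines_sum: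
  assumes "\<And>s. s \<in> S \<Longrightarrow> polynomial_on_lines (F s)"
  shows "polynomial_on_lines (\<lambda>x. \<Sum>s\<in>S. F s x)"
  using assms by (induction S rule: infinite_finite_induct)
    (auto intro: polynomial_on_lines_const polynomial_on_lines_add)

lemma polynomial_on_lines_prod:
  assumes "\<And>s. s \<in> S \<Longrightarrow> polynomial_on_lines (F s)"
  shows "polynomial_on_lines (\<lambda>x. \<Prod>s\<in>S. F s x)"
  using assms by (induction S rule: infinite_finite_induct)
    (auto intro: polynomial_on_lines_const polynomial_on_lines_mult)

lemmas polynomial_on_lines_intros =
  polynomial_on_lines_const polynomial_on_lines_coord polynomial_on_lines_add
  polynomial_on_lines_mult polynomial_on_lines_minus polynomial_on_lines_diff
  polynomial_on_lines_power polynomial_on_lines_sum polynomial_on_lines_prod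

lemma polynomial_on_lines_eval_mpoly:
  assumes "\<And>v. polynomial_on_lines (F v)"
  shows "polynomial_on_lines (\<lambda>x. eval_mpoly (\<lambda>v. F v x) p)"
  unfolding eval_mpoly_def eval_monom_def by (intro polynomial_on_lines_intros assms)

text \<open>On the line through \<open>a\<close> and \<open>b\<close> both restrictions are nonzero
  polynomials, so their product has a non-root. This plays the part of the density of nonempty
  Zariski open sets.\<close>

lemma polynomial_on_lines_common_nonzero:
  fixes F G :: "('i \<Rightarrow> 'a) \<Rightarrow> 'a::{idom, ring_char_0}"
  assumes "polynomial_on_lines F" "polynomial_on_lines G" and F: "F a \<noteq> 0" and G: "G b \<noteq> 0"
  shows "\<exists>c. F c \<noteq> 0 \<and> G c \<noteq> 0"
proof -
  obtain P where P: "\<And>t. F (\<lambda>i. a i + t * (b i - a i)) = poly P t"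
    using assms(1) by (rule polynomial_on_linesE[where a = a and b = "\<lambda>i. b i - a i"]) blast
  obtain Q where Q: "\<And>t. G (\<lambda>i. a i + t * (b i - a i)) = poly Q t"
    using assms(2) by (rule polynomial_on_linesE[where a = a and b = "\<lambda>i. b i - a i"]) blast
  have "poly P 0 \<noteq> 0" "poly Q 1 \<noteq> 0"
    using P[of 0] Q[of 1] F G by simp_all
  then have "P * Q \<noteq> 0"
    by auto
  then obtain t where "poly (P * Q) t \<noteq> 0"
    using poly_all_0_iff_0 by blast
  then show ?thesis
    by (intro exI[of _ "\<lambda>i. a i + t * (b i - a i)"]) (simp add: P Q)
qed

lemma polynomial_on_lines_common_nonzero_finite:
  fixes F :: "'s \<Rightarrow> ('i \<Rightarrow> 'a) \<Rightarrow> 'a::{idom, ring_char_0}"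
  assumes "finite S" "\<And>s. s \<in> S \<Longrightarrow> polynomial_on_lines (F s)"
    and "\<And>s. s \<in> S \<Longrightarrow> \<exists>a. F s a \<noteq> 0"
  shows "\<exists>c. \<forall>s\<in>S. F s c \<noteq> 0"
proof -
  have "\<exists>c. (\<Prod>s\<in>S. F s c) \<noteq> 0"
    using assms
  proof (induction S rule: finite_induct)
    case (insert s S)
    then obtain a b where "F s a \<noteq> 0" "(\<Prod>s\<in>S. F s b) \<noteq> 0"
      by (metis insertCI)
    then show ?case
      using polynomial_on_lines_common_nonzero[of "F s" "\<lambda>x. \<Prod>s\<in>S. F s x" a b] insert
      by (auto intro: polynomial_on_lines_prod)
  qed simp
  then show ?thesis
    using assms(1) by auto
qed

section \<open>Linear forms and the cofactor of a factor vanishing on all their hyperplanes\<close>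

definition linear_form :: "('m::finite \<Rightarrow> complex) \<Rightarrow> ('m option \<Rightarrow> complex) \<Rightarrow> complex" where
  "linear_form u x = x None + (\<Sum>i\<in>UNIV. u i * x (Some i))"

lemma polynomial_on_lines_linear_form: "polynomial_on_lines (linear_form u)"
  unfolding linear_form_def by (intro polynomial_on_lines_intros)

lemma linear_form_line:
  "linear_form u (\<lambda>v. a v + t * b v) = linear_form u a + t * linear_form u b"
  by (simp add: linear_form_def algebra_simps sum.distrib sum_distrib_left)

text \<open>Two different forms are separated by a coordinate vector, so each difference is nonzero
  somewhere; finitely many such conditions hold at a common point.\<close>

lemma ex_linear_forms_distinct:
  fixes S :: "('m::finite \<Rightarrow> complex) set"
  assumes "finite S"
  shows "\<exists>a. inj_on (\<lambda>u. linear_form u a) S"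
proof -
  let ?S = "{(u, v). u \<in> S \<and> v \<in> S \<and> u \<noteq> v}"
  have "\<exists>c. \<forall>s\<in>?S. linear_form (fst s) c - linear_form (snd s) c \<noteq> 0"
  proof (rule polynomial_on_lines_common_nonzero_finite)
    show "finite ?S"
      by (rule finite_subset[of _ "S \<times> S"]) (use assms in auto)
  next
    fix s assume "s \<in> ?S"
    then obtain i where i: "fst s i \<noteq> snd s i"
      by fastforce
    define a where "a = (\<lambda>v. if v = Some i then 1 else 0 :: complex)"
    have "linear_form u a = u i" for u
      by (simp add: linear_form_def a_def if_distrib cong: if_cong)
    then show "\<exists>a. linear_form (fst s) a - linear_form (snd s) a \<noteq> 0"
      using i by (intro exI[of _ a]) simp
  qed (intro polynomial_on_lines_intros polynomial_on_lines_linear_form)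
  then show ?thesis
    by (auto simp: inj_on_def)
qed

text \<open>Where the forms have distinct zeros on a line, \<open>A\<close> has
  \<open>card S\<close> zeros there, which uses up the whole degree of the product and leaves degree
  0 for \<open>B\<close>.\<close>

lemma cofactor_constant:
  fixes S :: "('m::finite \<Rightarrow> complex) set"
  assumes S: "finite S"
    and A: "polynomial_on_lines A" and B: "polynomial_on_lines B"
    and AB: "\<And>x. A x * B x = (\<Prod>u\<in>S. linear_form u x)"
    and zero: "\<And>u x. u \<in> S \<Longrightarrow> linear_form u x = 0 \<Longrightarrow> A x = 0"
  shows "\<exists>c. \<forall>x. B x = c"
proof -
  obtain a where a: "inj_on (\<lambda>u. linear_form u a) S"
    using ex_linear_forms_distinct[OF S] by blast
  have on_line: "B (\<lambda>v. a v + b v) = B a"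
    \<comment> \<open>\<open>b0\<close> makes each form nonconstant on the line; the second
      condition says that different forms vanish at different parameters.\<close>
    if b0: "\<forall>u\<in>S. linear_form u b \<noteq> 0"
      and b: "\<forall>u\<in>S. \<forall>v\<in>S. u \<noteq> v \<longrightarrow>
        linear_form u a * linear_form v b - linear_form v a * linear_form u b \<noteq> 0" for b
  proof -
    obtain P where P: "\<And>t. A (\<lambda>i. a i + t * b i) = poly P t"
      using A by (rule polynomial_on_linesE[where a = a and b = b]) blast
    obtain Q where Q: "\<And>t. B (\<lambda>i. a i + t * b i) = poly Q t"
      using B by (rule polynomial_on_linesE[where a = a and b = b]) blast
    define R where "R = (\<Prod>u\<in>S. [:linear_form u a, linear_form u b:])"
    have "poly (P * Q) t = poly R t" for t
      using AB[of "\<lambda>i. a i + t * b i"] by (simp add: P Q R_def poly_prod linear_form_line)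
    then have PQ: "P * Q = R"
      by (intro poly_eq_poly_eq_iff[THEN iffD1] ext)
    have "R \<noteq> 0"
      unfolding R_def using S b0 by simp
    then have "P \<noteq> 0" "Q \<noteq> 0"
      using PQ by auto
    \<comment> \<open>The parameter at which the line meets the hyperplane of
      \<open>u\<close>.\<close>
    define t where "t u = - linear_form u a / linear_form u b" for u
    have "inj_on t S"
      by (rule inj_onI) (use b0 b in \<open>auto simp: t_def field_simps\<close>)
    moreover have "t ` S \<subseteq> {s. poly P s = 0}"
    proof safe
      fix u assume u: "u \<in> S"
      then have "linear_form u (\<lambda>i. a i + t u * b i) = 0"
        using b0 unfolding linear_form_line by (simp add: t_def)
      then show "poly P (t u) = 0"
        using zero[OF u] P by metis
    qed
    ultimately have "card S \<le> card {s. poly P s = 0}"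
      using poly_roots_finite[OF \<open>P \<noteq> 0\<close>] by (metis card_image card_mono)
    also have "\<dots> \<le> degree P"
      using \<open>P \<noteq> 0\<close> by (rule card_poly_roots_bound)
    finally have "card S \<le> degree P" .
    moreover have "degree R \<le> card S"
    proof -
      have "degree R \<le> (\<Sum>u\<in>S. degree [:linear_form u a, linear_form u b:])"
        unfolding R_def by (rule degree_prod_sum_le[OF S, unfolded o_def])
      also have "\<dots> \<le> (\<Sum>u\<in>S. 1)"
        by (rule sum_mono) simp
      finally show ?thesis by simp
    qed
    moreover have "degree R = degree P + degree Q"
      using PQ \<open>P \<noteq> 0\<close> \<open>Q \<noteq> 0\<close> degree_mult_eq by metis
    ultimately have "degree Q = 0"
      by simp
    then obtain c where "Q = [:c:]"
      by (rule degree_eq_zeroE)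
    then show ?thesis
      using Q[of 0] Q[of 1] by simp
  qed
  \<comment> \<open>A direction violating this could be perturbed to a generic one still violating
    it, against \<open>on_line\<close>.\<close>
  have const: "B (\<lambda>v. a v + b v) = B a" for b
  proof (rule ccontr)
    assume neq: "B (\<lambda>v. a v + b v) \<noteq> B a"
    \<comment> \<open>\<open>e\<close> is a generic direction: all forms are 1 on it, and the second
      condition reduces to the distinctness of the forms at \<open>a\<close>.\<close>
    define e :: "'m option \<Rightarrow> complex" where "e = (\<lambda>v. if v = None then 1 else 0)"
    have e: "linear_form u e = 1" for u
      by (simp add: linear_form_def e_def)
    define D where "D x = B (\<lambda>v. a v + x v) - B a" for x
    have D: "polynomial_on_lines D"
    proof -
      have "\<exists>P. \<forall>t. B (\<lambda>v. a v + (c v + t * d v)) = poly P t" for c d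
        using B unfolding polynomial_on_lines_def by (simp add: add.assoc[symmetric])
      then have "polynomial_on_lines (\<lambda>x. B (\<lambda>v. a v + x v))"
        unfolding polynomial_on_lines_def by blast
      then show ?thesis
        unfolding D_def by (intro polynomial_on_lines_intros)
    qed
    have "\<exists>x. \<forall>(u, v)\<in>S \<times> S. linear_form u x \<noteq> 0 \<and>
      (u \<noteq> v \<longrightarrow> linear_form u a * linear_form v x - linear_form v a * linear_form u x \<noteq> 0) \<and> D x \<noteq> 0"
    proof -
      \<comment> \<open>All conditions in one family over pairs. On the diagonal the last factor is
        set to 1, since the difference vanishes identically there.\<close>
      define F where "F s x = linear_form (fst s) x * D x *
        (if fst s = snd s then 1 else
         linear_form (fst s) a * linear_form (snd s) x - linear_form (snd s) a * linear_form (fst s) x)"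
        for s x
      have "\<exists>x. \<forall>s\<in>S \<times> S. F s x \<noteq> 0"
      proof (rule polynomial_on_lines_common_nonzero_finite)
        fix s assume s: "s \<in> S \<times> S"
        let ?G = "\<lambda>x. linear_form (fst s) x * (if fst s = snd s then 1 else
         linear_form (fst s) a * linear_form (snd s) x - linear_form (snd s) a * linear_form (fst s) x)"
        have G: "polynomial_on_lines ?G"
          by (cases "fst s = snd s") (simp_all add: polynomial_on_lines_intros polynomial_on_lines_linear_form)
        have "?G e \<noteq> 0"
          using a s by (auto simp: e inj_on_def)
        then obtain x where "?G x \<noteq> 0 \<and> D x \<noteq> 0"
          using polynomial_on_lines_common_nonzero[OF G D, of e b] neq by (auto simp: D_def)
        then show "\<exists>x. F s x \<noteq> 0"
          by (intro exI[of _ x]) (simp add: F_def)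
        have "F s = (\<lambda>x. ?G x * D x)"
          by (auto simp: F_def)
        then show "polynomial_on_lines (F s)"
          using polynomial_on_lines_mult[OF G D] by simp
      qed (use S in simp)
      then show ?thesis
        by (fastforce simp: F_def)
    qed
    then obtain x where x: "\<forall>u\<in>S. \<forall>v\<in>S. linear_form u x \<noteq> 0 \<and> D x \<noteq> 0 \<and>
      (u \<noteq> v \<longrightarrow> linear_form u a * linear_form v x - linear_form v a * linear_form u x \<noteq> 0)"
      by auto
    show False
    \<comment> \<open>For empty \<open>S\<close> the pairs say nothing about \<open>D x\<close>, but
      then every direction is generic, including \<open>b\<close>.\<close>
    proof (cases "S = {}")
      case True
      then show False
        using on_line[of b] neq by simp
    next
      case False
      then show False
        using on_line[of x] x by (auto simp: D_def)
    qed
  qed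
  have "B x = B a" for x
    using const[of "\<lambda>v. x v - a v"] by simp
  then show ?thesis
    by blast
qed

section \<open>Units and irreducibility\<close>

text \<open>Every point has coordinates that are \<open>n\<close>-th powers, so \<open>p\<close>
  takes only the value \<open>c\<close> and is the constant polynomial \<open>c\<close>.\<close>

lemma mpoly_unit_of_constant_powers:
  fixes p :: "('v::finite, complex) mpoly"
  assumes r: "\<And>t::complex. r t ^ n = t" and c: "\<And>x. eval_mpoly (\<lambda>v. x v ^ n) p = c" and "c \<noteq> 0"
  shows "p dvd 1"
proof -
  have "eval_mpoly f p = c" for f
    using c[of "\<lambda>v. r (f v)"] by (simp add: r)
  then have "1 = p * Poly_Mapping.single 0 (1 / c)"
    using \<open>c \<noteq> 0\<close> by (intro mpoly_eqI) (simp add: eval_mpoly_mult eval_monom_def)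
  then show ?thesis
    by (rule dvdI)
qed

theorem corollary6p1:
  fixes n :: nat and \<epsilon> :: complex and r :: "complex \<Rightarrow> complex"
  assumes "n > 0"
    and "primitive_root_of_unity n \<epsilon>"
    and "\<And>t. r t ^ n = t"
  shows "irreducible (root_poly n \<epsilon> r :: ('m::finite option, complex) mpoly)"
proof -
  note r = assms(3)
  define S :: "('m \<Rightarrow> complex) set" where "S = (UNIV \<rightarrow> {u. u ^ n = 1})"
  have finS: "finite S"
    using finite_PiE[of "UNIV :: 'm set" "\<lambda>_. {u::complex. u ^ n = 1}"] finite_roots_unity[of n] assms(1)
    by (simp add: S_def PiE_UNIV_domain)
  have oneS: "(\<lambda>_. 1) \<in> S"
    by (simp add: S_def)
  let ?p = "root_poly n \<epsilon> r :: ('m option, complex) mpoly"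
  let ?E = "\<lambda>q :: ('m option, complex) mpoly. \<lambda>x. eval_mpoly (\<lambda>v. x v ^ n) q"
  have p: "?E ?p x = (\<Prod>u\<in>S. linear_form u x)" for x
  proof -
    have "(\<lambda>v. x v ^ n) = case_option (x None ^ n) (\<lambda>i. x (Some i) ^ n)"
      by (auto split: option.split)
    then show ?thesis
      using eval_root_poly[OF assms(2,3), of "x None" "x None ^ n" "\<lambda>i. x (Some i)" "\<lambda>i. x (Some i) ^ n"]
      by (simp add: root_product_altdef[OF assms(2)] S_def linear_form_def)
  qed
  \<comment> \<open>Every form is 1 at \<open>e\<close> and 0 at the origin, so \<open>?p\<close>
    takes the values 1 and 0: it is neither zero nor a unit.\<close>
  define e :: "'m option \<Rightarrow> complex" where "e = (\<lambda>v. if v = None then 1 else 0)"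
  have pe: "?E ?p e = 1"
    unfolding p by (simp add: linear_form_def e_def)
  have p0: "?E ?p (\<lambda>_. 0) = 0"
    unfolding p using finS oneS by (auto simp: linear_form_def card_gt_0_iff)
  have E: "polynomial_on_lines (?E q)" for q
    by (intro polynomial_on_lines_eval_mpoly polynomial_on_lines_intros)
  have unit: "b dvd 1"
    if "?p = a * b" and zero: "\<And>x. linear_form (\<lambda>_. 1) x = 0 \<Longrightarrow> ?E a x = 0" for a b
  proof -
    have ab: "?E a x * ?E b x = ?E ?p x" for x
      using that(1) by (simp add: eval_mpoly_mult)
    have "\<exists>c. \<forall>x. ?E b x = c"
    proof (rule cofactor_constant[OF finS E E])
      show "?E a x * ?E b x = (\<Prod>u\<in>S. linear_form u x)" for x
        using ab p by simp
    next
      fix u x assume u: "u \<in> S" "linear_form u x = 0"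
      \<comment> \<open>Scaling by roots of unity keeps the \<open>n\<close>-th powers and carries
        the hyperplane of \<open>u\<close> into that of the all-ones form.\<close>
      define x' where "x' = (\<lambda>v. case v of None \<Rightarrow> x None | Some i \<Rightarrow> u i * x (Some i))"
      have "(\<lambda>v. x' v ^ n) = (\<lambda>v. x v ^ n)"
        using u(1) by (auto simp: x'_def S_def Pi_iff power_mult_distrib split: option.split)
      moreover have "linear_form (\<lambda>_. 1) x' = 0"
        using u(2) by (simp add: linear_form_def x'_def)
      ultimately show "?E a x = 0"
        using zero[of x'] by simp
    qed
    then obtain c where c: "\<And>x. ?E b x = c"
      by blast
    moreover have "c \<noteq> 0"
      using ab[of e] pe c by auto
    ultimately show ?thesis
      by (rule mpoly_unit_of_constant_powers[of r n, OF r])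
  qed
  show ?thesis
  proof (rule irreducibleI)
    show "?p \<noteq> 0"
      using pe by auto
    show "\<not> ?p dvd 1"
    proof
      assume "?p dvd 1"
      then obtain q where "1 = ?p * q"
        by (rule dvdE)
      then have "?E 1 (\<lambda>_. 0) = ?E (?p * q) (\<lambda>_. 0)"
        by simp
      then show False
        using p0 by (simp add: eval_mpoly_mult)
    qed
  next
    fix a b assume ab: "?p = a * b"
    \<comment> \<open>\<open>proj\<close> is the projection onto the hyperplane of the all-ones form
      along the \<open>None\<close> axis. Composed with it, \<open>a\<close> and \<open>b\<close>
      stay polynomial on lines, so a zero product forces one of them to vanish on the
      hyperplane.\<close>
    define proj :: "('m option \<Rightarrow> complex) \<Rightarrow> 'm option \<Rightarrow> complex"
      where "proj x v = (case v of None \<Rightarrow> - (\<Sum>i\<in>UNIV. x (Some i)) | Some i \<Rightarrow> x (Some i))" for x v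
    have proj_id: "proj x = x" if "linear_form (\<lambda>_. 1) x = 0" for x
      using that by (auto simp: proj_def linear_form_def eq_neg_iff_add_eq_0 add.commute
        neg_eq_iff_add_eq_0 split: option.split)
    have "polynomial_on_lines (\<lambda>x. proj x v)" for v
      unfolding proj_def
      by (cases v; simp only: option.case) (intro polynomial_on_lines_intros)+
    then have pr: "polynomial_on_lines (\<lambda>x. ?E q (proj x))" for q
      by (intro polynomial_on_lines_eval_mpoly polynomial_on_lines_intros)
    have "?E a (proj x) * ?E b (proj x) = 0" for x
    proof -
      have "?E a (proj x) * ?E b (proj x) = (\<Prod>u\<in>S. linear_form u (proj x))"
        using p[of "proj x"] by (simp add: ab eval_mpoly_mult)
      also have "\<dots> = 0"
        using finS oneS by (intro prod_zero bexI[of _ "\<lambda>_. 1"]) (auto simp: linear_form_def proj_def)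
      finally show ?thesis .
    qed
    then have "(\<forall>x. ?E a (proj x) = 0) \<or> (\<forall>x. ?E b (proj x) = 0)"
      using polynomial_on_lines_common_nonzero[OF pr[of a] pr[of b]] by (metis mult_eq_0_iff)
    then show "a dvd 1 \<or> b dvd 1"
    proof
      assume "\<forall>x. ?E a (proj x) = 0"
      then have "b dvd 1"
        using proj_id by (intro unit[OF ab]) metis
      then show ?thesis ..
    next
      assume "\<forall>x. ?E b (proj x) = 0"
      then have "a dvd 1"
        using proj_id by (intro unit[of b a]) (metis ab mult.commute)+
      then show ?thesis ..
    qed
  qed
qed

end
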